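(* For all integers $k > j \geq 1$, $\mathsf{RT}^1_k \not\leq_{\mathrm{W}} \mathsf{TT}^1_j$.
   Context: A problem is a partial multivalued function from $\omega^\omega$ to $\omega^\omega$ with nonempty solution sets on its domain (its instances); objects are coded in $\omega^\omega$ via standard codings. $\mathsf{P} \leq_{\mathrm{W}} \mathsf{Q}$ means there are Turing functionals $\Phi,\Psi$ such that for every instance $x$ of $\mathsf{P}$, $\Phi(x)$ is an instance of $\mathsf{Q}$, and for every $\mathsf{Q}$-solution $y$ of $\Phi(x)$, $\Psi(x\oplus y)$ is a $\mathsf{P}$-solution of $x$. $\mathsf{RT}^1_k$: instances are all $f:\omega\to k=\{0,\dots,k-1\}$, solutions all infinite $M\subseteq\omega$ on which $f$ is constant. $\mathsf{TT}^1_j$: instances are all $f:2^{<\omega}\to j$, solutions all $H\subseteq 2^{<\omega}$ such that $(H,\preceq)$ is order-isomorphic to $(2^{<\omega},\preceq)$ ($\preceq$ the prefix order) and $f$ is constant on $H$. *)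

theory Defs
  imports Main "HOL-Library.Sublist"
begin

type_synonym baire = "nat \<Rightarrow> nat"

text \<open>
  Turing functionals, via the partial recursive functions relative to an oracle (Kleene).
  \<open>Zero\<close> is the constant 0 of every arity, \<open>Proj i\<close> the projection to the \<open>i\<close>-th
  argument (counted from 0). An application with an unsuitable number of arguments diverges.
\<close>

datatype prog =
    Zero
  | Succ
  | Proj nat
  | Oracle
  | Comp prog "prog list"
  | PrimRec prog prog
  | Mu prog

text \<open>\<open>eval X p xs y\<close>: with oracle \<open>X\<close>, \<open>p\<close> halts on the arguments \<open>xs\<close> with output \<open>y\<close>.\<close>

inductive eval :: "baire \<Rightarrow> prog \<Rightarrow> nat list \<Rightarrow> nat \<Rightarrow> bool" for X :: baire where
  eval_Zero: "eval X Zero xs 0"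
| eval_Succ: "eval X Succ [n] (Suc n)"
| eval_Proj: "i < length xs \<Longrightarrow> eval X (Proj i) xs (xs ! i)"
| eval_Oracle: "eval X Oracle [n] (X n)"
| eval_Comp: "length ys = length ps \<Longrightarrow> (\<forall>i<length ps. eval X (ps ! i) xs (ys ! i)) \<Longrightarrow>
    eval X p ys z \<Longrightarrow> eval X (Comp p ps) xs z"
| eval_PrimRec_0: "eval X p xs z \<Longrightarrow> eval X (PrimRec p q) (0 # xs) z"
| eval_PrimRec_Suc: "eval X (PrimRec p q) (n # xs) r \<Longrightarrow> eval X q (n # r # xs) z \<Longrightarrow>
    eval X (PrimRec p q) (Suc n # xs) z"
| eval_Mu: "eval X p (n # xs) 0 \<Longrightarrow> (\<forall>m<n. \<exists>v>0. eval X p (m # xs) v) \<Longrightarrow>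
    eval X (Mu p) xs n"

inductive_cases eval_ZeroE: "eval X Zero xs y"
inductive_cases eval_SuccE: "eval X Succ xs y"
inductive_cases eval_ProjE: "eval X (Proj i) xs y"
inductive_cases eval_OracleE: "eval X Oracle xs y"
inductive_cases eval_CompE: "eval X (Comp p ps) xs y"
inductive_cases eval_PrimRec_0E: "eval X (PrimRec p q) (0 # xs) y"
inductive_cases eval_PrimRec_SucE: "eval X (PrimRec p q) (Suc n # xs) y"
inductive_cases eval_MuE: "eval X (Mu p) xs y"

lemma eval_deterministic: "eval X p xs y \<Longrightarrow> eval X p xs y' \<Longrightarrow> y' = y"
proof (induction arbitrary: y' rule: eval.induct)
  case (eval_Zero xs)
  then show ?case by (rule eval_ZeroE)
next
  case (eval_Succ n)
  then show ?case by (auto elim: eval_SuccE)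
next
  case (eval_Proj i xs)
  from eval_Proj(2) show ?case by (auto elim: eval_ProjE)
next
  case (eval_Oracle n)
  then show ?case by (auto elim: eval_OracleE)
next
  case (eval_Comp ys ps xs p z)
  from eval_Comp.prems obtain ys' where ys': "length ys' = length ps"
    "\<forall>i<length ps. eval X (ps ! i) xs (ys' ! i)" "eval X p ys' y'"
    by (auto elim: eval_CompE)
  have "ys' = ys"
    by (rule nth_equalityI) (use ys' eval_Comp.IH eval_Comp.hyps in auto)
  then show ?case using ys' eval_Comp.IH by auto
next
  case (eval_PrimRec_0 p xs z q)
  from eval_PrimRec_0.prems eval_PrimRec_0.IH show ?case by (auto elim: eval_PrimRec_0E)
next
  case (eval_PrimRec_Suc p q n xs r z)
  from eval_PrimRec_Suc.prems obtain r' where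
    "eval X (PrimRec p q) (n # xs) r'" "eval X q (n # r' # xs) y'"
    by (auto elim: eval_PrimRec_SucE)
  then show ?case using eval_PrimRec_Suc.IH by blast
next
  case (eval_Mu p n xs)
  from eval_Mu.prems have n': "eval X p (y' # xs) 0" "\<forall>m<y'. \<exists>v>0. eval X p (m # xs) v"
    by (auto elim: eval_MuE)
  show ?case
  proof (rule linorder_cases[of y' n])
    assume "y' < n"
    then obtain v where "v > 0" "\<forall>w. eval X p (y' # xs) w \<longrightarrow> w = v"
      using eval_Mu.IH by blast
    then show ?thesis using n'(1) by auto
  next
    assume "n < y'"
    then obtain v where "v > 0" "eval X p (n # xs) v" using n'(2) by blast
    then show ?thesis using eval_Mu.IH(1)[of v] by simp
  qed
qed

text \<open>
  A Turing functional is a partial function on Baire space: \<open>\<Phi> X\<close> is defined iff the program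
  halts with oracle \<open>X\<close> on every input, and is then the function so computed.
\<close>

definition turing_functional :: "(baire \<Rightarrow> baire option) \<Rightarrow> bool" where
  "turing_functional \<Phi> \<longleftrightarrow>
     (\<exists>p. \<forall>X Y. \<Phi> X = Some Y \<longleftrightarrow> (\<forall>n. eval X p [n] (Y n)))"

definition join :: "baire \<Rightarrow> baire \<Rightarrow> baire"  (infixl "\<oplus>" 65) where
  "x \<oplus> y = (\<lambda>n. if even n then x (n div 2) else y (n div 2))"

text \<open>The intended values are those satisfying \<open>is_problem\<close>.\<close>

datatype problem =
  Problem (instances: "baire set") (solutions: "baire \<Rightarrow> baire set")

definition is_problem :: "problem \<Rightarrow> bool" where
  "is_problem P \<longleftrightarrow> (\<forall>x\<in>instances P. solutions P x \<noteq> {})"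

definition weihrauch_le :: "problem \<Rightarrow> problem \<Rightarrow> bool"  (infix "\<le>\<^sub>W" 50) where
  "P \<le>\<^sub>W Q \<longleftrightarrow>
     (\<exists>\<Phi> \<Psi>. turing_functional \<Phi> \<and> turing_functional \<Psi> \<and>
       (\<forall>x\<in>instances P. \<exists>u\<in>instances Q. \<Phi> x = Some u \<and>
         (\<forall>y\<in>solutions Q u. \<exists>z\<in>solutions P x. \<Psi> (x \<oplus> y) = Some z)))"

text \<open>Subsets of \<open>\<omega>\<close> are coded by their characteristic functions.\<close>

definition chi :: "nat set \<Rightarrow> baire" where
  "chi A = (\<lambda>n. of_bool (n \<in> A))"

text \<open>
  The nodes of the full binary tree are finite bit strings, of type \<open>bool list\<close>, coded by
  their position in the length-lexicographic order. In binary, \<open>str_code s + 1\<close> is the digit 1 followed by \<open>s\<close>.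
\<close>

definition str_code :: "bool list \<Rightarrow> nat" where
  "str_code = foldl (\<lambda>c b. 2 * c + (if b then 2 else 1)) 0"

lemma bij_str_code: "bij str_code"
proof (rule bijI)
  have code_snoc: "str_code (s @ [b]) = 2 * str_code s + (if b then 2 else 1)" for s b
    by (simp add: str_code_def)
  have nil: "str_code [] = 0" by (simp add: str_code_def)
  have "str_code s = str_code t \<Longrightarrow> s = t" for s t
  proof (induction s arbitrary: t rule: rev_induct)
    case Nil
    then show ?case by (cases t rule: rev_cases) (auto simp: code_snoc nil split: if_splits)
  next
    case (snoc b s)
    show ?case
    proof (cases t rule: rev_cases)
      case Nil
      then show ?thesis using snoc.prems by (auto simp: code_snoc nil split: if_splits)
    next
      case (snoc t' c)
      then have "2 * str_code s + (if b then 2 else 1) = 2 * str_code t' + (if c then 2 else 1)"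
        using snoc.prems by (simp add: code_snoc)
      then have "b = c \<and> str_code s = str_code t'"
        by (cases b; cases c; simp) presburger+
      then show ?thesis using snoc snoc.IH by simp
    qed
  qed
  then show "inj str_code" by (rule injI)
  have "\<exists>s. str_code s = n" for n
  proof (induction n rule: less_induct)
    case (less n)
    show ?case
    proof (cases "n = 0")
      case True
      then show ?thesis using nil by blast
    next
      case False
      then obtain s where s: "str_code s = (n - 1) div 2"
        using less[of "(n - 1) div 2"] by fastforce
      have "str_code (s @ [even n]) = n"
        unfolding code_snoc s using False by simp presburger
      then show ?thesis by blast
    qed
  qed
  then show "surj str_code" by (metis surj_def)
qed

definition RT1 :: "nat \<Rightarrow> problem" where
  "RT1 k = Problem
     {f. \<forall>n. f n < k}
     (\<lambda>f. {chi M | M. infinite M \<and> (\<exists>c. \<forall>n\<in>M. f n = c)})"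

definition iso_full_binary_tree :: "bool list set \<Rightarrow> bool" where
  "iso_full_binary_tree H \<longleftrightarrow>
     (\<exists>\<phi> :: bool list \<Rightarrow> bool list. bij_betw \<phi> UNIV H \<and> (\<forall>s t. prefix s t \<longleftrightarrow> prefix (\<phi> s) (\<phi> t)))"

text \<open>The instance \<open>g\<close> codes the colouring \<open>g \<circ> str_code\<close> of the full binary tree.\<close>

definition TT1 :: "nat \<Rightarrow> problem" where
  "TT1 j = Problem
     {g. \<forall>s. g (str_code s) < j}
     (\<lambda>g. {chi (str_code ` H) | H.
        iso_full_binary_tree H \<and> (\<exists>c. \<forall>s\<in>H. g (str_code s) = c)})"

lemma is_problem_RT1: "is_problem (RT1 k)"
proof -
  have "\<exists>M. infinite M \<and> (\<exists>c. \<forall>n\<in>M. f n = c)" if "\<forall>n. f n < k" for f :: baire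
  proof -
    have "finite (range f)" by (rule finite_subset[of _ "{..<k}"]) (use that in auto)
    then obtain a where "infinite {n. f n = f a}"
      using pigeonhole_infinite[of UNIV f] by auto
    then show ?thesis by blast
  qed
  then show ?thesis unfolding is_problem_def RT1_def by auto
qed

lemma iso_full_binary_tree_if_dense:
  fixes p :: "bool list \<Rightarrow> bool list" and f :: "bool list \<Rightarrow> nat"
  assumes p: "\<And>s. prefix r s \<Longrightarrow> prefix s (p s) \<and> f (p s) = c"
  shows "\<exists>H. iso_full_binary_tree H \<and> (\<forall>s\<in>H. f s = c)"
proof -
  define \<psi> where "\<psi> = rec_list (p r) (\<lambda>b _ u. p (u @ [b]))"
  define \<phi> where "\<phi> = (\<lambda>s. \<psi> (rev s))"
  have nil: "\<phi> [] = p r" and phi_snoc: "\<phi> (s @ [b]) = p (\<phi> s @ [b])" for s b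
    by (simp_all add: \<phi>_def \<psi>_def)
  have ext: "prefix r (\<phi> s)" for s
  proof (induction s rule: rev_induct)
    case Nil
    then show ?case using p[of r] by (simp add: nil)
  next
    case (snoc b s)
    then have "prefix r (\<phi> s @ [b])" by (rule prefix_prefix)
    then show ?case unfolding phi_snoc using p prefix_order.trans by blast
  qed
  have step: "prefix (\<phi> s @ [b]) (\<phi> (s @ [b]))" for s b
    unfolding phi_snoc using p[of "\<phi> s @ [b]"] ext[of s] by (simp add: prefix_prefix)
  have col: "f (\<phi> s) = c" for s
    by (cases s rule: rev_cases) (simp_all add: nil phi_snoc p ext prefix_prefix)
  have mono: "prefix (\<phi> s) (\<phi> (s @ t))" for s t
  proof (induction t rule: rev_induct)
    case (snoc b t)
    then show ?case using step[of "s @ t" b]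
      by (metis append_assoc append_prefixD prefix_order.trans)
  qed simp
  have step': "prefix (\<phi> s @ [b]) (\<phi> (s @ b # t))" for s b t
    using step[of s b] mono[of "s @ [b]" t] prefix_order.trans by fastforce
  have iff: "prefix s t \<longleftrightarrow> prefix (\<phi> s) (\<phi> t)" for s t
  proof
    show "prefix s t \<Longrightarrow> prefix (\<phi> s) (\<phi> t)" using mono by (auto simp: prefix_def)
    assume le: "prefix (\<phi> s) (\<phi> t)"
    show "prefix s t"
    proof (rule ccontr)
      assume nle: "\<not> prefix s t"
      show False
      proof (cases "strict_prefix t s")
        case True
        then obtain b u where "s = t @ b # u" by (auto elim: strict_prefixE')
        then have "prefix (\<phi> t @ [b]) (\<phi> t)" using step'[of t b u] le prefix_order.trans by blast
        then show False using prefix_length_le by fastforce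
      next
        case False
        then have "s \<parallel> t" using nle by (auto simp: parallel_def strict_prefix_def)
        then obtain as b bs b' cs where st: "b \<noteq> b'" "s = as @ b # bs" "t = as @ b' # cs"
          using parallel_decomp[OF \<open>s \<parallel> t\<close>] by metis
        have "prefix (\<phi> as @ [b]) (\<phi> t)"
          using step'[of as b bs] le unfolding st(2) by (rule prefix_order.trans)
        moreover have "prefix (\<phi> as @ [b']) (\<phi> t)"
          using step'[of as b' cs] unfolding st(3) .
        ultimately have "prefix (\<phi> as @ [b]) (\<phi> as @ [b']) \<or> prefix (\<phi> as @ [b']) (\<phi> as @ [b])"
          using prefix_same_cases by blast
        then show False using st(1) by auto
      qed
    qed
  qed
  then have "inj \<phi>" by (metis injI prefix_order.eq_iff)
  then have "iso_full_binary_tree (range \<phi>)"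
    unfolding iso_full_binary_tree_def using iff by (auto simp: bij_betw_def)
  then show ?thesis using col by blast
qed

lemma is_problem_TT1: "is_problem (TT1 j)"
proof -
  have ex: "\<exists>H. iso_full_binary_tree H \<and> (\<exists>c. \<forall>s\<in>H. f s = c)"
    if "\<And>s. prefix r s \<Longrightarrow> f s < j" for f :: "bool list \<Rightarrow> nat" and r
    using that
  proof (induction j arbitrary: r)
    case 0
    then show ?case by blast
  next
    case (Suc j)
    show ?case
    proof (cases "\<exists>s. prefix r s \<and> (\<forall>t. prefix s t \<longrightarrow> f t \<noteq> j)")
      case True
      then obtain s where s: "prefix r s" "\<And>t. prefix s t \<Longrightarrow> f t \<noteq> j" by blast
      have "f t < j" if "prefix s t" for t
        using Suc.prems[of t] s that prefix_order.trans[of r s t] by fastforce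
      then show ?thesis using Suc.IH by blast
    next
      case False
      then obtain p where "\<And>s. prefix r s \<Longrightarrow> prefix s (p s) \<and> f (p s) = j" by metis
      then show ?thesis using iso_full_binary_tree_if_dense by blast
    qed
  qed
  have "\<exists>H. iso_full_binary_tree H \<and> (\<exists>c. \<forall>s\<in>H. g (str_code s) = c)"
    if "\<forall>s. g (str_code s) < j" for g :: baire
    using ex[of "[]" "g \<circ> str_code"] that by simp
  then show ?thesis unfolding is_problem_def TT1_def by auto
qed

end

theory Submission
  imports Defs
begin

text \<open>
  Only the continuity of the two functionals matters. Suppose that for all instances \<open>f\<close>
  extending a fixed finite one by colours from \<open>C\<close>, the tree colouring \<open>\<Phi> f\<close> takes above \<open>r\<close>
  only colours from \<open>D\<close>, where \<open>D\<close> has fewer elements than \<open>C\<close>. Some \<open>c \<in> D\<close> is dense for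
  \<open>\<Phi> f\<close> above some \<open>r'\<close>, so there is a tree of colour \<open>c\<close>, and a finite part of it together
  with a finite part of \<open>f\<close> commits \<open>\<Psi>\<close> to a number of some colour \<open>d \<in> C\<close>. If \<open>d\<close> is used
  no more, then this finite part cannot be completed to a solution, so \<open>c\<close> is not dense above
  \<open>r'\<close> for any of the remaining instances. By Baire category there are a single node \<open>s\<close> above
  \<open>r'\<close> and a longer finite instance such that \<open>c\<close> never occurs above \<open>s\<close>. Thus \<open>d\<close> is removed
  from \<open>C\<close> and \<open>c\<close> from \<open>D\<close>; after finitely many rounds \<open>D\<close> is empty while \<open>C\<close> is not.
\<close>

section \<open>Finite agreement and continuity of Turing functionals\<close>

definition eq_upto :: "nat \<Rightarrow> baire \<Rightarrow> baire \<Rightarrow> bool" where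
  "eq_upto m f g \<longleftrightarrow> (\<forall>i<m. f i = g i)"

lemma eq_upto_refl [simp]: "eq_upto m f f"
  by (simp add: eq_upto_def)

lemma eq_upto_trans: "eq_upto m f g \<Longrightarrow> eq_upto m g h \<Longrightarrow> eq_upto m f h"
  by (simp add: eq_upto_def)

lemma eq_upto_mono: "eq_upto m f g \<Longrightarrow> l \<le> m \<Longrightarrow> eq_upto l f g"
  by (simp add: eq_upto_def)

text \<open>The use principle: a halting computation queries its oracle at finitely many places. The
  form with \<open>eventually\<close> lets the bounds of finitely many subcomputations be
  merged.\<close>

lemma eventually_eval_eq_upto:
  "eval X p xs y \<Longrightarrow> eventually (\<lambda>m. \<forall>X'. eq_upto m X X' \<longrightarrow> eval X' p xs y) sequentially"
proof (induction rule: eval.induct)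
  case (eval_Oracle n)
  show ?case
    using eventually_gt_at_top[of n]
    by eventually_elim (metis eq_upto_def eval.eval_Oracle)
next
  case (eval_Comp ys ps xs p z)
  have "eventually (\<lambda>m. \<forall>i\<in>{..<length ps}. \<forall>X'. eq_upto m X X' \<longrightarrow> eval X' (ps ! i) xs (ys ! i))
      sequentially"
    using eval_Comp.IH(1) by (intro eventually_ball_finite) auto
  then show ?case
    using eval_Comp.IH(2)
    by eventually_elim (use eval_Comp.hyps in \<open>auto intro!: eval.eval_Comp\<close>)
next
  case (eval_PrimRec_Suc p q n xs r z)
  from eval_PrimRec_Suc.IH show ?case
    by eventually_elim (blast intro: eval.eval_PrimRec_Suc)
next
  case (eval_PrimRec_0 p xs z q)
  from eval_PrimRec_0.IH show ?case
    by eventually_elim (blast intro: eval.eval_PrimRec_0)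
next
  case (eval_Mu p n xs)
  from eval_Mu.IH(2) have "\<forall>l. \<exists>v. l < n \<longrightarrow> v > 0 \<and>
      eventually (\<lambda>m. \<forall>X'. eq_upto m X X' \<longrightarrow> eval X' p (l # xs) v) sequentially"
    by blast
  from choice[OF this] obtain v where v: "\<And>l. l < n \<Longrightarrow> v l > 0"
    "\<And>l. l < n \<Longrightarrow> eventually (\<lambda>m. \<forall>X'. eq_upto m X X' \<longrightarrow> eval X' p (l # xs) (v l)) sequentially"
    by blast
  then have "eventually (\<lambda>m. \<forall>l\<in>{..<n}. \<forall>X'. eq_upto m X X' \<longrightarrow> eval X' p (l # xs) (v l)) sequentially"
    by (intro eventually_ball_finite) auto
  then show ?case
    using eval_Mu.IH(1)
    by eventually_elim (use v(1) in \<open>blast intro: eval.eval_Mu\<close>)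
qed (auto intro!: always_eventually intro: eval.intros)

lemma turing_functional_continuous:
  assumes "turing_functional \<Phi>" and "\<Phi> X = Some Y"
  shows "\<exists>m. \<forall>X' Y'. eq_upto m X X' \<longrightarrow> \<Phi> X' = Some Y' \<longrightarrow> Y' n = Y n"
proof -
  obtain p where p: "\<And>X Y. \<Phi> X = Some Y \<longleftrightarrow> (\<forall>n. eval X p [n] (Y n))"
    using assms(1) unfolding turing_functional_def by blast
  then have "eval X p [n] (Y n)" using assms(2) by blast
  then obtain m where "\<forall>X'. eq_upto m X X' \<longrightarrow> eval X' p [n] (Y n)"
    using eventually_eval_eq_upto unfolding eventually_sequentially by blast
  then show ?thesis using p eval_deterministic by metis
qed

lemma eq_upto_join:
  "eq_upto m x x' \<Longrightarrow> eq_upto m y y' \<Longrightarrow> eq_upto m (x \<oplus> y) (x' \<oplus> y')"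
  by (auto simp: eq_upto_def join_def)

section \<open>Baire category in closed sets of instances\<close>

text \<open>Nested neighbourhoods: step \<open>i\<close> moves within \<open>A\<close> to a point
  with a neighbourhood that settles \<open>P i\<close>; the limit of these points stays in
  \<open>A\<close> because \<open>A\<close> is closed.\<close>

lemma baire_category:
  assumes closed: "\<And>f. (\<And>m. \<exists>h\<in>A. eq_upto m f h) \<Longrightarrow> f \<in> A"
    and f0: "f0 \<in> A"
    and "open": "\<And>(i::nat) f. f \<in> A \<Longrightarrow> P i f \<Longrightarrow> \<exists>m. \<forall>f'\<in>A. eq_upto m f f' \<longrightarrow> P i f'"
    and dense: "\<And>i f m. f \<in> A \<Longrightarrow> \<exists>f'\<in>A. eq_upto m f f' \<and> P i f'"
  shows "\<exists>f\<in>A. \<forall>i. P i f"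
proof -
  have step: "\<exists>f' m'. f' \<in> A \<and> m < m' \<and> eq_upto m f f' \<and> (\<forall>h\<in>A. eq_upto m' f' h \<longrightarrow> P i h)"
    if f: "f \<in> A" for f m i
  proof -
    obtain f' where f': "f' \<in> A" "eq_upto m f f'" "P i f'" using dense[OF f] by blast
    then obtain l where l: "\<forall>h\<in>A. eq_upto l f' h \<longrightarrow> P i h" using "open" by blast
    \<comment> \<open>The strict increase makes the agreement lengths unbounded, so that they
      determine the limit.\<close>
    have "m < Suc (max l m)" "l \<le> Suc (max l m)" by auto
    then show ?thesis using f' l eq_upto_mono by blast
  qed
  have "\<exists>F :: nat \<Rightarrow> baire \<times> nat. \<forall>n. (fst (F n) \<in> A) \<and>
      (snd (F n) < snd (F (Suc n)) \<and> eq_upto (snd (F n)) (fst (F n)) (fst (F (Suc n))) \<and>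
       (\<forall>h\<in>A. eq_upto (snd (F (Suc n))) (fst (F (Suc n))) h \<longrightarrow> P n h))"
  proof (rule dependent_nat_choice)
    show "\<exists>p :: baire \<times> nat. fst p \<in> A" using f0 by auto
  next
    fix p :: "baire \<times> nat" and n
    assume "fst p \<in> A"
    then obtain f' m' where "f' \<in> A \<and> snd p < m' \<and> eq_upto (snd p) (fst p) f' \<and>
        (\<forall>h\<in>A. eq_upto m' f' h \<longrightarrow> P n h)"
      using step by blast
    then show "\<exists>q. fst q \<in> A \<and> snd p < snd q \<and> eq_upto (snd p) (fst p) (fst q) \<and>
        (\<forall>h\<in>A. eq_upto (snd q) (fst q) h \<longrightarrow> P n h)"
      by (intro exI[of _ "(f', m')"]) simp
  qed
  then obtain F :: "nat \<Rightarrow> baire \<times> nat" where "\<forall>n. fst (F n) \<in> A \<and>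
      (snd (F n) < snd (F (Suc n)) \<and> eq_upto (snd (F n)) (fst (F n)) (fst (F (Suc n))) \<and>
       (\<forall>h\<in>A. eq_upto (snd (F (Suc n))) (fst (F (Suc n))) h \<longrightarrow> P n h))" ..
  then have F: "fst (F n) \<in> A" "snd (F n) < snd (F (Suc n))"
    "eq_upto (snd (F n)) (fst (F n)) (fst (F (Suc n)))"
    "h \<in> A \<Longrightarrow> eq_upto (snd (F (Suc n))) (fst (F (Suc n))) h \<Longrightarrow> P n h" for n h
    by blast+
  have mono: "snd (F n) \<le> snd (F (n + d))" for n d
  proof (induction d)
    case (Suc d)
    then show ?case using F(2)[of "n + d"] by simp
  qed simp
  have ge: "n \<le> snd (F n)" for n
  proof (induction n)
    case (Suc n)
    then show ?case using F(2)[of n] by simp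
  qed simp
  have ext: "eq_upto (snd (F n)) (fst (F n)) (fst (F (n + d)))" for n d
  proof (induction d)
    case (Suc d)
    have "eq_upto (snd (F n)) (fst (F (n + d))) (fst (F (Suc (n + d))))"
      using F(3) mono by (rule eq_upto_mono)
    then show ?case using Suc.IH eq_upto_trans by simp
  qed simp
  \<comment> \<open>Entry \<open>i\<close> is final from stage \<open>Suc i\<close> on, since the
    agreement length there exceeds \<open>i\<close>.\<close>
  define f where "f = (\<lambda>i. fst (F (Suc i)) i)"
  have lim: "eq_upto (snd (F n)) (fst (F n)) f" for n
    unfolding eq_upto_def
  proof (intro allI impI)
    fix i assume i: "i < snd (F n)"
    show "fst (F n) i = f i"
    proof (cases "n \<le> Suc i")
      case True
      then show ?thesis using ext[of n "Suc i - n"] i by (simp add: f_def eq_upto_def)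
    next
      case False
      have "i < snd (F (Suc i))" using ge[of "Suc i"] by simp
      then show ?thesis using ext[of "Suc i" "n - Suc i"] False by (simp add: f_def eq_upto_def)
    qed
  qed
  have "f \<in> A"
  proof (rule closed)
    fix m
    have "eq_upto m f (fst (F m))" using lim[of m] ge[of m] by (simp add: eq_upto_def)
    then show "\<exists>h\<in>A. eq_upto m f h" using F(1) by blast
  qed
  then show ?thesis using F(4) lim by blast
qed

text \<open>Restricting colours only from \<open>N\<close> on lets a colour be retired after a
  finite part using it has been fixed.\<close>

definition cylinder :: "baire \<Rightarrow> nat \<Rightarrow> nat set \<Rightarrow> baire set" where
  "cylinder g N C = {f. eq_upto N g f \<and> (\<forall>i\<ge>N. f i \<in> C)}"

lemma cylinder_nonempty: "C \<noteq> {} \<Longrightarrow> cylinder g N C \<noteq> {}"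
proof -
  assume "C \<noteq> {}"
  then obtain d where "d \<in> C" by blast
  then have "(\<lambda>i. if i < N then g i else d) \<in> cylinder g N C"
    by (simp add: cylinder_def eq_upto_def)
  then show ?thesis by blast
qed

lemma cylinder_closed: "(\<And>m. \<exists>h\<in>cylinder g N C. eq_upto m f h) \<Longrightarrow> f \<in> cylinder g N C"
proof -
  assume closed: "\<And>m. \<exists>h\<in>cylinder g N C. eq_upto m f h"
  have "(i < N \<longrightarrow> g i = f i) \<and> (N \<le> i \<longrightarrow> f i \<in> C)" for i
  proof -
    obtain h where "h \<in> cylinder g N C" "eq_upto (Suc i) f h" using closed by blast
    then show ?thesis by (simp add: cylinder_def eq_upto_def)
  qed
  then show ?thesis by (simp add: cylinder_def eq_upto_def)
qed

lemma cylinder_subset: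
  assumes "f \<in> cylinder g N C" "N \<le> N'" "C' \<subseteq> C"
  shows "cylinder f N' C' \<subseteq> cylinder g N C"
proof
  fix h assume h: "h \<in> cylinder f N' C'"
  have "h i \<in> C" if "N \<le> i" for i
    using h assms that unfolding cylinder_def eq_upto_def by (cases "i < N'") (auto simp: subset_eq)
  then show "h \<in> cylinder g N C"
    using h assms unfolding cylinder_def eq_upto_def by auto
qed

section \<open>Dense colours and monochromatic trees\<close>

definition dense_above :: "(bool list \<Rightarrow> bool) \<Rightarrow> bool list \<Rightarrow> bool" where
  "dense_above P r \<longleftrightarrow> (\<forall>s. prefix r s \<longrightarrow> (\<exists>t. prefix s t \<and> P t))"

text \<open>If \<open>d\<close> is not dense above \<open>r\<close>, it is absent above some
  \<open>s\<close>, and the induction continues there with one colour fewer.\<close>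

lemma ex_dense_colour:
  assumes "finite D" and "\<And>s. prefix r s \<Longrightarrow> f s \<in> D"
  shows "\<exists>c\<in>D. \<exists>r'. prefix r r' \<and> dense_above (\<lambda>s. f s = c) r'"
  using assms
proof (induction D arbitrary: r rule: finite_induct)
  case empty
  then show ?case by blast
next
  case (insert d D)
  show ?case
  proof (cases "dense_above (\<lambda>s. f s = d) r")
    case True
    then show ?thesis by blast
  next
    case False
    then obtain s where s: "prefix r s" "\<And>t. prefix s t \<Longrightarrow> f t \<noteq> d"
      unfolding dense_above_def by blast
    then have "f t \<in> D" if "prefix s t" for t
      using insert.prems[of t] that prefix_order.trans by blast
    then show ?thesis using insert.IH[of s] s(1) prefix_order.trans by blast
  qed
qed

lemma str_code_snoc: "str_code (s @ [b]) = 2 * str_code s + (if b then 2 else 1)"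
  by (simp add: str_code_def)

lemma str_code_mono: "prefix s t \<Longrightarrow> str_code s \<le> str_code t"
proof -
  have "str_code s \<le> str_code (s @ u)" for u
    by (induction u rule: rev_induct) (simp_all add: str_code_snoc flip: append_assoc)
  then show "prefix s t \<Longrightarrow> ?thesis" by (auto simp: prefix_def)
qed

lemma str_code_ge_length: "length s \<le> str_code s"
  by (induction s rule: rev_induct) (auto simp: str_code_snoc)

lemma inj_str_code: "inj str_code"
  using bij_str_code by (rule bij_is_inj)

text \<open>
  Not every order embedding of the tree is of this kind: the images of \<open>s @ [False]\<close> and
  \<open>s @ [True]\<close> may also branch at a node properly extending the image of \<open>s\<close>.
\<close>

definition tree_embedding :: "(bool list \<Rightarrow> bool list) \<Rightarrow> bool" where
  "tree_embedding \<phi> \<longleftrightarrow> (\<forall>s b. prefix (\<phi> s @ [b]) (\<phi> (s @ [b])))"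

lemma tree_embedding_mono:
  assumes "tree_embedding \<phi>" and "prefix s t"
  shows "prefix (\<phi> s) (\<phi> t)"
proof -
  have "prefix (\<phi> s) (\<phi> (s @ u))" for u
  proof (induction u rule: rev_induct)
    case (snoc b u)
    then show ?case using assms(1) unfolding tree_embedding_def
      by (metis append_assoc append_prefixD prefix_order.trans)
  qed simp
  then show ?thesis using assms(2) by (auto simp: prefix_def)
qed

text \<open>The order is reflected: incomparable nodes separate at some \<open>as\<close>, and their
  images pass through different children of \<open>\<phi> as\<close>.\<close>

lemma iso_full_binary_tree_range:
  assumes "tree_embedding \<phi>"
  shows "iso_full_binary_tree (range \<phi>)"
proof -
  have step: "prefix (\<phi> s @ [b]) (\<phi> (s @ b # t))" for s b t
  proof -
    have "prefix (\<phi> s @ [b]) (\<phi> (s @ [b]))" using assms by (simp add: tree_embedding_def)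
    also have "prefix \<dots> (\<phi> (s @ b # t))" by (rule tree_embedding_mono[OF assms]) simp
    finally show ?thesis .
  qed
  have "prefix s t" if le: "prefix (\<phi> s) (\<phi> t)" for s t
  proof (rule ccontr)
    assume nle: "\<not> prefix s t"
    show False
    proof (cases "strict_prefix t s")
      case True
      then obtain b u where "s = t @ b # u" by (auto elim: strict_prefixE')
      then have "prefix (\<phi> t @ [b]) (\<phi> t)" using step[of t b u] le prefix_order.trans by blast
      then show False using prefix_length_le by fastforce
    next
      case False
      then have "s \<parallel> t" using nle by (auto simp: parallel_def strict_prefix_def)
      then obtain as b bs b' cs where st: "b \<noteq> b'" "s = as @ b # bs" "t = as @ b' # cs"
        using parallel_decomp[OF \<open>s \<parallel> t\<close>] by metis
      have "prefix (\<phi> as @ [b]) (\<phi> t)"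
        using step[of as b bs] le unfolding st(2) by (rule prefix_order.trans)
      moreover have "prefix (\<phi> as @ [b']) (\<phi> t)" using step st(3) by simp
      ultimately have "prefix (\<phi> as @ [b]) (\<phi> as @ [b']) \<or> prefix (\<phi> as @ [b']) (\<phi> as @ [b])"
        using prefix_same_cases by blast
      then show False using st(1) by auto
    qed
  qed
  then have iff: "prefix s t \<longleftrightarrow> prefix (\<phi> s) (\<phi> t)" for s t
    using tree_embedding_mono[OF assms] by blast
  then have "inj \<phi>" by (metis injI prefix_order.eq_iff)
  then show ?thesis
    unfolding iso_full_binary_tree_def using iff by (auto simp: bij_betw_def)
qed

text \<open>Serves to pass from one colouring to another: only nodes of code below \<open>m\<close>
  are kept, and density replaces all others by nodes of code at least \<open>m\<close>.\<close>

lemma tree_embedding_extend: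
  assumes \<phi>: "tree_embedding \<phi>" "prefix r (\<phi> [])"
    and dense: "dense_above P r"
    and P: "\<And>s. str_code (\<phi> s) < m \<Longrightarrow> P (\<phi> s)"
  shows "\<exists>\<phi>'. tree_embedding \<phi>' \<and> prefix r (\<phi>' []) \<and> (\<forall>s. P (\<phi>' s)) \<and>
    (\<forall>t. str_code t < m \<longrightarrow> (t \<in> range \<phi> \<longleftrightarrow> t \<in> range \<phi>'))"
proof -
  have "\<exists>t. prefix u t \<and> P t \<and> m \<le> str_code t" if "prefix r u" for u
  proof -
    \<comment> \<open>Padding with \<open>m\<close> bits pushes the code to at least
      \<open>m\<close>, as codes dominate lengths.\<close>
    have "prefix r (u @ replicate m True)" using that by (rule prefix_prefix)
    then obtain t where t: "prefix (u @ replicate m True) t" "P t"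
      using dense unfolding dense_above_def by blast
    then have "prefix u t" by (blast dest: append_prefixD)
    moreover have "m \<le> str_code t"
      using prefix_length_le[OF t(1)] str_code_ge_length[of t] by simp
    ultimately show ?thesis using t(2) by blast
  qed
  then obtain q where q: "\<And>u. prefix r u \<Longrightarrow> prefix u (q u)" "\<And>u. prefix r u \<Longrightarrow> P (q u)"
    "\<And>u. prefix r u \<Longrightarrow> m \<le> str_code (q u)" by metis
  define S where "S = {s. str_code (\<phi> s) < m}"
  \<comment> \<open>List recursion works from the front whereas the tree grows at the end of a
    string, hence the reversals.\<close>
  define \<psi> where "\<psi> = rec_list (if [] \<in> S then \<phi> [] else q r)
    (\<lambda>b s u. if rev s @ [b] \<in> S then \<phi> (rev s @ [b]) else q (u @ [b]))"
  define \<phi>' where "\<phi>' = (\<lambda>s. \<psi> (rev s))"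
  have nil: "\<phi>' [] = (if [] \<in> S then \<phi> [] else q r)"
    and snoc: "\<phi>' (s @ [b]) = (if s @ [b] \<in> S then \<phi> (s @ [b]) else q (\<phi>' s @ [b]))" for s b
    by (simp_all add: \<phi>'_def \<psi>_def)
  have S_same: "\<phi>' s = \<phi> s" if "s \<in> S" for s
    using that by (cases s rule: rev_cases) (simp_all add: nil snoc)
  \<comment> \<open>Codes grow along prefixes, so a kept node has a kept parent, whose image is
    unchanged.\<close>
  have S_init: "s \<in> S" if "s @ [b] \<in> S" for s b
    using str_code_mono[OF tree_embedding_mono[OF \<phi>(1), of s "s @ [b]"]] that by (simp add: S_def)
  have above\<phi>: "prefix r (\<phi> s)" for s
    using tree_embedding_mono[OF \<phi>(1), of "[]" s] \<phi>(2) prefix_order.trans by auto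
  have above: "prefix r (\<phi>' s)" for s
  proof (induction s rule: rev_induct)
    case Nil
    then show ?case using q(1)[of r] \<phi>(2) by (simp add: nil)
  next
    case (snoc b s)
    then have "prefix r (\<phi>' s @ [b])" by (rule prefix_prefix)
    then have "prefix r (q (\<phi>' s @ [b]))" using q(1) prefix_order.trans by blast
    then show ?case using above\<phi> by (simp add: \<open>\<And>s b. \<phi>' (s @ [b]) = _\<close>)
  qed
  have above_snoc: "prefix r (\<phi>' s @ [b])" for s b
    using above by (rule prefix_prefix)
  have "tree_embedding \<phi>'"
    unfolding tree_embedding_def
  proof (intro allI)
    fix s b
    show "prefix (\<phi>' s @ [b]) (\<phi>' (s @ [b]))"
    proof (cases "s @ [b] \<in> S")
      case True
      then show ?thesis using S_same S_init[OF True] \<phi>(1) by (simp add: tree_embedding_def)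
    next
      case False
      then show ?thesis using q(1) above_snoc by (simp add: snoc)
    qed
  qed
  moreover have "P (\<phi>' s)" for s
    by (cases s rule: rev_cases) (use P q(2) above_snoc in \<open>auto simp: nil snoc S_def\<close>)
  moreover have new: "m \<le> str_code (\<phi>' s)" if "s \<notin> S" for s
    by (cases s rule: rev_cases) (use that q(3) above_snoc in \<open>auto simp: nil snoc\<close>)
  have "t \<in> range \<phi> \<longleftrightarrow> t \<in> range \<phi>'" if "str_code t < m" for t
  proof
    assume "t \<in> range \<phi>"
    then obtain s where "t = \<phi> s" by blast
    then have "t = \<phi>' s" using that S_same by (simp add: S_def)
    then show "t \<in> range \<phi>'" by blast
  next
    assume "t \<in> range \<phi>'"
    then obtain s where s: "t = \<phi>' s" by blast
    then have "s \<in> S" using that new by fastforce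
    then show "t \<in> range \<phi>" using S_same s by simp
  qed
  ultimately show ?thesis using above by blast
qed

lemma ex_tree_embedding:
  assumes "dense_above P r"
  shows "\<exists>\<phi>. tree_embedding \<phi> \<and> prefix r (\<phi> []) \<and> (\<forall>s. P (\<phi> s))"
proof -
  \<comment> \<open>With \<open>m = 0\<close> no node is kept, so any embedding above
    \<open>r\<close> can be the starting point.\<close>
  have "tree_embedding (\<lambda>s. r @ s)" by (simp add: tree_embedding_def)
  from tree_embedding_extend[OF this _ assms, where m = 0] show ?thesis by auto
qed

section \<open>Elimination of colours\<close>

text \<open>
  Here \<open>u f\<close> stands for the tree colouring produced from the instance \<open>f\<close>, and \<open>solve\<close> says
  that a finite part of \<open>f\<close> and of a monochromatic tree already commits the backward functional
  to some \<open>n \<ge> N\<close>, hence to the colour \<open>f n\<close>.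
\<close>

lemma no_continuous_colour_reduction:
  fixes u :: "baire \<Rightarrow> bool list \<Rightarrow> nat"
  assumes cont: "\<And>f s. range f \<subseteq> K \<Longrightarrow>
      \<exists>m. \<forall>f'. range f' \<subseteq> K \<longrightarrow> eq_upto m f f' \<longrightarrow> u f' s = u f s"
    and solve: "\<And>f \<phi> c N. range f \<subseteq> K \<Longrightarrow> tree_embedding \<phi> \<Longrightarrow> (\<And>s. u f (\<phi> s) = c) \<Longrightarrow>
      \<exists>n\<ge>N. \<exists>m. \<forall>f' \<phi>'. range f' \<subseteq> K \<longrightarrow> tree_embedding \<phi>' \<longrightarrow> (\<forall>s. u f' (\<phi>' s) = c) \<longrightarrow>
        eq_upto m f f' \<longrightarrow> (\<forall>t. str_code t < m \<longrightarrow> (t \<in> range \<phi> \<longleftrightarrow> t \<in> range \<phi>')) \<longrightarrow>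
        infinite {i. f' i = f n}"
    and "finite D" and "card D < card C" and "cylinder g N C \<subseteq> {f. range f \<subseteq> K}"
    and "\<And>f s. f \<in> cylinder g N C \<Longrightarrow> prefix r s \<Longrightarrow> u f s \<in> D"
  shows False
  using assms(3-)
proof (induction "card D" arbitrary: D C g N r)
  case 0
  then have "cylinder g N C \<noteq> {}" by (intro cylinder_nonempty) auto
  then show False using 0 by auto
next
  case (Suc a)
  note cyl = Suc.prems(3) and colours = Suc.prems(4)
  have C: "finite C" using Suc.prems(2) by (metis card.infinite not_less_zero)
  have "cylinder g N C \<noteq> {}" using Suc.prems(2) by (intro cylinder_nonempty) auto
  then obtain f where f: "f \<in> cylinder g N C" by blast
  have fK: "range f \<subseteq> K" using f cyl by blast
  obtain c r' where c: "c \<in> D" and r': "prefix r r'" "dense_above (\<lambda>s. u f s = c) r'"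
    using ex_dense_colour[of D r "u f"] Suc.prems(1) colours[OF f] by blast
  obtain \<phi> where \<phi>: "tree_embedding \<phi>" "prefix r' (\<phi> [])" "\<And>s. u f (\<phi> s) = c"
    using ex_tree_embedding[OF r'(2)] by blast
  obtain n m where n: "N \<le> n" and m: "\<And>f' \<phi>'. range f' \<subseteq> K \<Longrightarrow> tree_embedding \<phi>' \<Longrightarrow>
      (\<forall>s. u f' (\<phi>' s) = c) \<Longrightarrow> eq_upto m f f' \<Longrightarrow>
      (\<forall>t. str_code t < m \<longrightarrow> (t \<in> range \<phi> \<longleftrightarrow> t \<in> range \<phi>')) \<Longrightarrow> infinite {i. f' i = f n}"
    using solve[OF fK \<phi>(1,3), of N] by blast
  have fn: "f n \<in> C" using f n by (simp add: cylinder_def)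
  define C' where "C' = C - {f n}"
  \<comment> \<open>One \<open>l\<close> for the finitely many nodes of code below \<open>m\<close>:
    instances agreeing with \<open>f\<close> up to \<open>l\<close> leave the small nodes of
    \<open>\<phi>\<close> in colour \<open>c\<close>.\<close>
  have "eventually (\<lambda>l. \<forall>t\<in>{t. str_code t < m}. \<forall>f'. range f' \<subseteq> K \<longrightarrow> eq_upto l f f' \<longrightarrow> u f' t = u f t)
      sequentially"
  proof (rule eventually_ball_finite)
    show "finite {t. str_code t < m}"
      using finite_vimageI[OF finite_lessThan[of m] inj_str_code] by (simp add: vimage_def)
    show "\<forall>t\<in>{t. str_code t < m}. eventually (\<lambda>l. \<forall>f'. range f' \<subseteq> K \<longrightarrow> eq_upto l f f' \<longrightarrow> u f' t = u f t)
      sequentially"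
    proof
      fix t
      obtain l where "\<forall>f'. range f' \<subseteq> K \<longrightarrow> eq_upto l f f' \<longrightarrow> u f' t = u f t"
        using cont[OF fK, of t] by blast
      then show "eventually (\<lambda>l. \<forall>f'. range f' \<subseteq> K \<longrightarrow> eq_upto l f f' \<longrightarrow> u f' t = u f t) sequentially"
        using eq_upto_mono unfolding eventually_sequentially by blast
    qed
  qed
  then obtain l where l: "\<And>t f'. str_code t < m \<Longrightarrow> range f' \<subseteq> K \<Longrightarrow> eq_upto l f f' \<Longrightarrow> u f' t = u f t"
    unfolding eventually_sequentially by blast
  define N' where "N' = Max {N, Suc n, m, l}"
  have N': "N \<le> N'" "Suc n \<le> N'" "m \<le> N'" "l \<le> N'" by (auto simp: N'_def)
  define A where "A = cylinder f N' C'"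
  have A_sub: "A \<subseteq> cylinder g N C"
    unfolding A_def C'_def using f N' by (intro cylinder_subset) auto
  \<comment> \<open>Otherwise the part of \<open>\<phi>\<close> below \<open>m\<close> would extend
    to a tree of colour \<open>c\<close> for \<open>f'\<close>, and \<open>solve\<close> would make
    \<open>f n\<close> occur infinitely often in \<open>f'\<close>, though it is barred from
    \<open>N'\<close> on.\<close>
  have not_dense: "\<not> dense_above (\<lambda>s. u f' s = c) r'" if f': "f' \<in> A" for f'
  proof
    assume d: "dense_above (\<lambda>s. u f' s = c) r'"
    have f'K: "range f' \<subseteq> K" using A_sub cyl f' by blast
    have eq: "eq_upto m f f'" "eq_upto l f f'"
      using f' N' unfolding A_def cylinder_def by (auto intro: eq_upto_mono)
    have "\<exists>\<phi>'. tree_embedding \<phi>' \<and> prefix r' (\<phi>' []) \<and> (\<forall>s. u f' (\<phi>' s) = c) \<and>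
        (\<forall>t. str_code t < m \<longrightarrow> (t \<in> range \<phi> \<longleftrightarrow> t \<in> range \<phi>'))"
      using \<phi> d by (rule_tac tree_embedding_extend) (auto simp: l[OF _ f'K eq(2)])
    then have "infinite {i. f' i = f n}" using m f'K eq(1) by blast
    moreover have "{i. f' i = f n} \<subseteq> {..<N'}"
      using f' unfolding A_def cylinder_def C'_def by (auto simp flip: not_le)
    ultimately show False using finite_subset by blast
  qed
  \<comment> \<open>Baire category makes the node witnessing non-density independent of the instance.\<close>
  have ex: "\<exists>s h L. prefix r' s \<and> h \<in> A \<and> (\<forall>f'\<in>A. eq_upto L h f' \<longrightarrow> (\<forall>t. prefix s t \<longrightarrow> u f' t \<noteq> c))"
  proof (rule ccontr)
    assume neg: "\<not> ?thesis"
    \<comment> \<open>The nodes above \<open>r'\<close> are enumerated by codes, as category handles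
      countably many conditions; all \<open>P i\<close> together say that \<open>c\<close> is dense
      above \<open>r'\<close>.\<close>
    define P where "P = (\<lambda>i f'. \<exists>t. prefix (r' @ inv str_code i) t \<and> u f' t = c)"
    have "\<exists>f'\<in>A. \<forall>i. P i f'"
    proof (rule baire_category)
      show "\<And>f. (\<And>m. \<exists>h\<in>A. eq_upto m f h) \<Longrightarrow> f \<in> A" unfolding A_def by (rule cylinder_closed)
      have "C' \<noteq> {}"
      proof -
        \<comment> \<open>\<open>D\<close> is nonempty in this round, so \<open>C\<close> has at
          least two colours.\<close>
        have "0 < card C'" using Suc.prems(2) Suc.hyps(2) C fn by (simp add: C'_def)
        then show ?thesis by auto
      qed
      then show "(SOME f. f \<in> A) \<in> A"
        unfolding A_def using cylinder_nonempty by (simp add: some_in_eq)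
      show "\<exists>m. \<forall>f'\<in>A. eq_upto m f f' \<longrightarrow> P i f'" if fA: "f \<in> A" and Pf: "P i f" for i f
      proof -
        obtain t where t: "prefix (r' @ inv str_code i) t" "u f t = c"
          using Pf unfolding P_def by blast
        have "range f \<subseteq> K" using fA A_sub cyl by blast
        then obtain m where "\<forall>f'. range f' \<subseteq> K \<longrightarrow> eq_upto m f f' \<longrightarrow> u f' t = u f t"
          using cont by blast
        moreover have "range f' \<subseteq> K" if "f' \<in> A" for f' using that A_sub cyl by blast
        ultimately show ?thesis using t unfolding P_def by metis
      qed
      \<comment> \<open>A failure would give a neighbourhood of \<open>f\<close> in \<open>A\<close>
        avoiding \<open>c\<close> above a single node, which \<open>neg\<close> excludes.\<close>
      show "\<exists>f'\<in>A. eq_upto m f f' \<and> P i f'" if "f \<in> A" for i f m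
        using neg that prefixI[OF refl, of r' "inv str_code i"] unfolding P_def by blast
    qed
    then obtain f' where f': "f' \<in> A" "\<And>i. P i f'" by blast
    have "\<exists>t. prefix s t \<and> u f' t = c" if s: "prefix r' s" for s
    proof -
      obtain v where "s = r' @ v" using s by (auto simp: prefix_def)
      then show ?thesis using f'(2)[of "str_code v"] inj_str_code unfolding P_def by simp
    qed
    then show False using not_dense[OF f'(1)] unfolding dense_above_def by blast
  qed
  then obtain s h L where s: "prefix r' s" and h: "h \<in> A"
    and avoid: "\<And>f' t. f' \<in> A \<Longrightarrow> eq_upto L h f' \<Longrightarrow> prefix s t \<Longrightarrow> u f' t \<noteq> c" by blast
  \<comment> \<open>Agreement up to \<open>L\<close> makes \<open>avoid\<close> applicable;
    agreement up to \<open>N'\<close> keeps the instances in \<open>A\<close>.\<close>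
  define B where "B = cylinder h (max L N') C'"
  have B_sub: "B \<subseteq> A" unfolding B_def A_def
    by (rule cylinder_subset) (use h in \<open>auto simp: A_def\<close>)
  show False
  proof (rule Suc.hyps(1))
    show "a = card (D - {c})" using Suc.hyps(2) c by simp
    show "finite (D - {c})" using Suc.prems(1) by simp
    show "card (D - {c}) < card C'" using Suc.prems(1,2) c C fn Suc.hyps(2) by (simp add: C'_def)
    show "cylinder h (max L N') C' \<subseteq> {f. range f \<subseteq> K}"
      using B_sub A_sub cyl unfolding B_def by blast
    fix f' t assume f': "f' \<in> cylinder h (max L N') C'" and t: "prefix s t"
    have f'A: "f' \<in> A" using f' B_sub unfolding B_def by blast
    have "eq_upto L h f'" using f' unfolding cylinder_def by (auto intro: eq_upto_mono)
    then have "u f' t \<noteq> c" using avoid f'A t by blast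
    moreover have "prefix r t" using r'(1) s t prefix_order.trans by blast
    then have "u f' t \<in> D" using colours f'A A_sub by blast
    ultimately show "u f' t \<in> D - {c}" by blast
  qed
qed

section \<open>Application to Weihrauch reductions\<close>

theorem theorem4p1:
  fixes j k :: nat
  assumes "1 \<le> j" and "j < k"
  shows "\<not> RT1 k \<le>\<^sub>W TT1 j"
proof
  assume "RT1 k \<le>\<^sub>W TT1 j"
  then obtain \<Phi> \<Psi> where tf: "turing_functional \<Phi>" "turing_functional \<Psi>"
    and red: "\<And>x. x \<in> instances (RT1 k) \<Longrightarrow> \<exists>v\<in>instances (TT1 j). \<Phi> x = Some v \<and>
         (\<forall>y\<in>solutions (TT1 j) v. \<exists>z\<in>solutions (RT1 k) x. \<Psi> (x \<oplus> y) = Some z)"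
    unfolding weihrauch_le_def by blast
  \<comment> \<open>\<open>the\<close> is unspecified off the domain of \<open>\<Phi>\<close>, but
    every \<open>f\<close> with colours below \<open>k\<close> lies in that domain.\<close>
  define u where "u = (\<lambda>f s. the (\<Phi> f) (str_code s))"
  have Phi: "\<Phi> f = Some (the (\<Phi> f))" and bound: "u f s < j" if "range f \<subseteq> {..<k}" for f s
  proof -
    have "f \<in> instances (RT1 k)" using that by (auto simp: RT1_def)
    then obtain v where "v \<in> instances (TT1 j)" "\<Phi> f = Some v" using red by blast
    then show "\<Phi> f = Some (the (\<Phi> f))" "u f s < j" by (simp_all add: TT1_def u_def)
  qed
  have Psi: "\<exists>M. infinite M \<and> (\<exists>d. \<forall>n\<in>M. f n = d) \<and> \<Psi> (f \<oplus> chi (str_code ` range \<phi>)) = Some (chi M)"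
    if f: "range f \<subseteq> {..<k}" and \<phi>: "tree_embedding \<phi>" "\<And>s. u f (\<phi> s) = c" for f \<phi> c
  proof -
    have x_inst: "f \<in> instances (RT1 k)" using f by (auto simp: RT1_def)
    have "chi (str_code ` range \<phi>) \<in> solutions (TT1 j) (the (\<Phi> f))"
      using iso_full_binary_tree_range[OF \<phi>(1)] \<phi>(2) unfolding TT1_def u_def by auto
    then have "\<exists>z\<in>solutions (RT1 k) f. \<Psi> (f \<oplus> chi (str_code ` range \<phi>)) = Some z"
      using red[OF x_inst] Phi[OF f] by (metis option.inject)
    then show ?thesis by (auto simp: RT1_def)
  qed
  show False
  proof (rule no_continuous_colour_reduction)
    show "\<exists>m. \<forall>f'. range f' \<subseteq> {..<k} \<longrightarrow> eq_upto m f f' \<longrightarrow> u f' s = u f s"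
      if "range f \<subseteq> {..<k}" for f s
      using turing_functional_continuous[OF tf(1), OF Phi[OF that], of "str_code s"] Phi
      unfolding u_def by metis
    show "\<exists>n\<ge>N. \<exists>m. \<forall>f' \<phi>'. range f' \<subseteq> {..<k} \<longrightarrow> tree_embedding \<phi>' \<longrightarrow> (\<forall>s. u f' (\<phi>' s) = c) \<longrightarrow>
        eq_upto m f f' \<longrightarrow> (\<forall>t. str_code t < m \<longrightarrow> (t \<in> range \<phi> \<longleftrightarrow> t \<in> range \<phi>')) \<longrightarrow>
        infinite {i. f' i = f n}"
      if f: "range f \<subseteq> {..<k}" and \<phi>: "tree_embedding \<phi>" "\<And>s. u f (\<phi> s) = c" for f \<phi> c N
    proof -
      obtain M where M: "infinite M" "\<Psi> (f \<oplus> chi (str_code ` range \<phi>)) = Some (chi M)"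
        using Psi[OF f \<phi>] by blast
      obtain n where n: "N \<le> n" "n \<in> M"
        using M(1) finite_subset[of M "{..<N}"] by (meson finite_lessThan lessThan_iff not_less subsetI)
      obtain m where m: "\<forall>X' Y'. eq_upto m (f \<oplus> chi (str_code ` range \<phi>)) X' \<longrightarrow>
          \<Psi> X' = Some Y' \<longrightarrow> Y' n = chi M n"
        using turing_functional_continuous[OF tf(2), OF M(2)] ..
      \<comment> \<open>Agreement up to \<open>m\<close> fixes the answer of \<open>\<Psi>\<close>
        about \<open>n\<close>; \<open>Suc n\<close> makes the two instances agree at
        \<open>n\<close> itself.\<close>
      have "infinite {i. f' i = f n}"
        if f': "range f' \<subseteq> {..<k}" "tree_embedding \<phi>'" "\<forall>s. u f' (\<phi>' s) = c"
          "eq_upto (max m (Suc n)) f f'"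
          and same: "\<forall>t. str_code t < max m (Suc n) \<longrightarrow> (t \<in> range \<phi> \<longleftrightarrow> t \<in> range \<phi>')" for f' \<phi>'
      proof -
        obtain M' d where M': "infinite M'" "\<forall>n\<in>M'. f' n = d"
          "\<Psi> (f' \<oplus> chi (str_code ` range \<phi>')) = Some (chi M')"
          using Psi[of f' \<phi>' c] f' by blast
        have "eq_upto m (chi (str_code ` range \<phi>)) (chi (str_code ` range \<phi>'))"
          unfolding eq_upto_def
        proof (intro allI impI)
          fix i assume i: "i < m"
          obtain t where t: "i = str_code t" using bij_str_code by (metis bij_pointE)
          show "chi (str_code ` range \<phi>) i = chi (str_code ` range \<phi>') i"
            using same i unfolding t chi_def inj_image_mem_iff[OF inj_str_code] by simp
        qed
        then have "eq_upto m (f \<oplus> chi (str_code ` range \<phi>)) (f' \<oplus> chi (str_code ` range \<phi>'))"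
          using f'(4) by (intro eq_upto_join) (auto intro: eq_upto_mono)
        then have "chi M' n = chi M n" using m M'(3) by blast
        \<comment> \<open>Membership of \<open>n\<close> identifies the colour of \<open>M'\<close>
          under \<open>f'\<close> as \<open>f' n\<close>, which is \<open>f n\<close>.\<close>
        then have "n \<in> M'" using n(2) by (simp add: chi_def of_bool_def split: if_splits)
        moreover have "f' n = f n" using f'(4) by (simp add: eq_upto_def)
        ultimately have "M' \<subseteq> {i. f' i = f n}" using M'(2) by auto
        then show ?thesis using M'(1) finite_subset by blast
      qed
      then show ?thesis using n(1) by blast
    qed
    \<comment> \<open>With \<open>N = 0\<close> the first cylinder consists of all instances of
      \<open>RT1 k\<close>.\<close>
    show "cylinder f 0 {..<k} \<subseteq> {f. range f \<subseteq> {..<k}}" for f by (auto simp: cylinder_def)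
    show "u f s \<in> {..<j}" if "f \<in> cylinder g 0 {..<k}" "prefix [] s" for f g s
      using that bound by (auto simp: cylinder_def)
    show "card {..<j} < card {..<k}" using assms(2) by simp
  qed simp
qed

end
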